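(* Let $\alpha\in\mathbb{R}$, $\alpha\neq0$. The coupled Burgers system $$\partial_t\rho+\partial_x(\rho u)=0,\qquad \partial_tu+\partial_x\Big(\frac{u^2+\alpha\rho^2}{2}\Big)=0,\qquad x\in\mathbb{R},\ t>0,$$ has a bi-Hamiltonian structure: $$\frac{\partial}{\partial t}\begin{pmatrix}\rho \\ u\end{pmatrix}=J\begin{pmatrix}\frac{\delta H_1^u}{\delta\rho}\\[2pt] \frac{\delta H_1^u}{\delta u}\end{pmatrix}=K\begin{pmatrix}\frac{\delta H_2^u}{\delta\rho}\\[2pt] \frac{\delta H_2^u}{\delta u}\end{pmatrix},$$ where $J$ and $K$ are the anti-symmetric operators $$J=\begin{pmatrix}-\frac1\alpha\partial_x&0 \\ 0&-\partial_x\end{pmatrix},\qquad K=\begin{pmatrix}0&-\partial_x \\ -\partial_x&0\end{pmatrix},$$ and $$H_1^u(\rho,u)=\int_{\mathbb{R}}\Big(\frac16u^3+\frac\alpha2\rho^2u\Big)dx,\qquad H_2^u(\rho,u)=\int_{\mathbb{R}}\Big(\frac12\rho u^2+\frac\alpha6\rho^3\Big)dx.$$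
   Context: $\frac{\delta H}{\delta\rho},\frac{\delta H}{\delta u}$ denote the variational ($L^2$) derivatives of a functional $H(\rho,u)$. Anti-symmetric means formally skew-adjoint with respect to the $L^2(\mathbb{R})^2$ pairing (on smooth functions decaying at infinity). "Bi-Hamiltonian structure" means that the system can be written in the two displayed Hamiltonian forms; that is, each of the two displayed equations is equivalent to the coupled Burgers system. *)

theory Defs
  imports "HOL-Analysis.Analysis"
begin

(* Smooth functions decaying at infinity, in the L2 sense needed by the pairing: all derivatives
   are square integrable and vanish at infinity. This contains the Schwartz functions, is closed
   under d/dx and products, and makes every integral below absolutely convergent. *)
definition decaying_smooth :: "(real \<Rightarrow> real) set" where
  "decaying_smooth = {f. \<forall>n. (\<forall>x. (deriv ^^ n) f differentiable (at x))
     \<and> integrable lborel (\<lambda>x. ((deriv ^^ n) f x)\<^sup>2)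
     \<and> ((deriv ^^ n) f \<longlongrightarrow> 0) at_infinity}"

definition L2_pairing ::
  "(real \<Rightarrow> real) \<times> (real \<Rightarrow> real) \<Rightarrow> (real \<Rightarrow> real) \<times> (real \<Rightarrow> real) \<Rightarrow> real" where
  "L2_pairing F G = (LBINT x. fst F x * fst G x + snd F x * snd G x)"

(* Formal skew-adjointness. Invariance of the domain guarantees that both pairings converge. *)
definition anti_symmetric ::
  "((real \<Rightarrow> real) \<times> (real \<Rightarrow> real) \<Rightarrow> (real \<Rightarrow> real) \<times> (real \<Rightarrow> real)) \<Rightarrow> bool" where
  "anti_symmetric A \<longleftrightarrow>
     (\<forall>F \<in> decaying_smooth \<times> decaying_smooth. A F \<in> decaying_smooth \<times> decaying_smooth) \<and>
     (\<forall>F \<in> decaying_smooth \<times> decaying_smooth. \<forall>G \<in> decaying_smooth \<times> decaying_smooth.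
        L2_pairing (A F) G = - L2_pairing F (A G))"

definition has_variational_derivative ::
  "((real \<Rightarrow> real) \<Rightarrow> real) \<Rightarrow> (real \<Rightarrow> real) \<Rightarrow> (real \<Rightarrow> real) \<Rightarrow> bool" where
  "has_variational_derivative F f g \<longleftrightarrow> g \<in> decaying_smooth \<and>
     (\<forall>\<phi> \<in> decaying_smooth.
        ((\<lambda>\<epsilon>. F (\<lambda>x. f x + \<epsilon> * \<phi> x)) has_real_derivative (LBINT x. g x * \<phi> x)) (at 0))"

(* There is at most one such g: the difference of two candidates is an admissible direction. *)
definition variational_derivative ::
  "((real \<Rightarrow> real) \<Rightarrow> real) \<Rightarrow> (real \<Rightarrow> real) \<Rightarrow> (real \<Rightarrow> real)" where
  "variational_derivative F f = (THE g. has_variational_derivative F f g)"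

type_synonym functional = "(real \<Rightarrow> real) \<Rightarrow> (real \<Rightarrow> real) \<Rightarrow> real"

definition delta_rho :: "functional \<Rightarrow> (real \<Rightarrow> real) \<Rightarrow> (real \<Rightarrow> real) \<Rightarrow> (real \<Rightarrow> real)" where
  "delta_rho H \<rho> u = variational_derivative (\<lambda>r. H r u) \<rho>"

definition delta_u :: "functional \<Rightarrow> (real \<Rightarrow> real) \<Rightarrow> (real \<Rightarrow> real) \<Rightarrow> (real \<Rightarrow> real)" where
  "delta_u H \<rho> u = variational_derivative (\<lambda>v. H \<rho> v) u"

definition variationally_differentiable :: "functional \<Rightarrow> bool" where
  "variationally_differentiable H \<longleftrightarrow>
     (\<forall>\<rho> \<in> decaying_smooth. \<forall>u \<in> decaying_smooth.
        (\<exists>g. has_variational_derivative (\<lambda>r. H r u) \<rho> g) \<and>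
        (\<exists>g. has_variational_derivative (\<lambda>v. H \<rho> v) u g))"

(* Time-dependent fields are written \<rho> t x, u t x; only their values for t > 0 matter. *)
definition admissible_field :: "(real \<Rightarrow> real \<Rightarrow> real) \<Rightarrow> bool" where
  "admissible_field w \<longleftrightarrow>
     (\<forall>t>0. w t \<in> decaying_smooth \<and> (\<forall>x. (\<lambda>s. w s x) differentiable (at t)))"

definition coupled_burgers ::
  "real \<Rightarrow> (real \<Rightarrow> real \<Rightarrow> real) \<Rightarrow> (real \<Rightarrow> real \<Rightarrow> real) \<Rightarrow> bool" where
  "coupled_burgers \<alpha> \<rho> u \<longleftrightarrow>
     (\<forall>t>0. \<forall>x.
        deriv (\<lambda>s. \<rho> s x) t + deriv (\<lambda>y. \<rho> t y * u t y) x = 0 \<and>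
        deriv (\<lambda>s. u s x) t + deriv (\<lambda>y. ((u t y)\<^sup>2 + \<alpha> * (\<rho> t y)\<^sup>2) / 2) x = 0)"

definition hamiltonian_form ::
  "((real \<Rightarrow> real) \<times> (real \<Rightarrow> real) \<Rightarrow> (real \<Rightarrow> real) \<times> (real \<Rightarrow> real)) \<Rightarrow> functional \<Rightarrow>
    (real \<Rightarrow> real \<Rightarrow> real) \<Rightarrow> (real \<Rightarrow> real \<Rightarrow> real) \<Rightarrow> bool" where
  "hamiltonian_form A H \<rho> u \<longleftrightarrow>
     (\<forall>t>0. (\<lambda>x. deriv (\<lambda>s. \<rho> s x) t, \<lambda>x. deriv (\<lambda>s. u s x) t)
        = A (delta_rho H (\<rho> t) (u t), delta_u H (\<rho> t) (u t)))"

definition J_op ::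
  "real \<Rightarrow> (real \<Rightarrow> real) \<times> (real \<Rightarrow> real) \<Rightarrow> (real \<Rightarrow> real) \<times> (real \<Rightarrow> real)" where
  "J_op \<alpha> F = (\<lambda>x. - (1 / \<alpha>) * deriv (fst F) x, \<lambda>x. - deriv (snd F) x)"

definition K_op ::
  "(real \<Rightarrow> real) \<times> (real \<Rightarrow> real) \<Rightarrow> (real \<Rightarrow> real) \<times> (real \<Rightarrow> real)" where
  "K_op F = (\<lambda>x. - deriv (snd F) x, \<lambda>x. - deriv (fst F) x)"

definition H1u :: "real \<Rightarrow> functional" where
  "H1u \<alpha> \<rho> u = (LBINT x. 1 / 6 * u x ^ 3 + \<alpha> / 2 * (\<rho> x)\<^sup>2 * u x)"

definition H2u :: "real \<Rightarrow> functional" where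
  "H2u \<alpha> \<rho> u = (LBINT x. 1 / 2 * \<rho> x * (u x)\<^sup>2 + \<alpha> / 6 * \<rho> x ^ 3)"

end

theory Submission
  imports Defs
begin

text \<open>
  Both Hamiltonians have integrands that are cubic polynomials in \<open>(\<rho>, u)\<close>. Replacing \<open>\<rho>\<close> by
  \<open>\<rho> + \<epsilon> \<phi>\<close> (or \<open>u\<close> by \<open>u + \<epsilon> \<phi>\<close>) therefore gives a cubic polynomial in \<open>\<epsilon>\<close> whose coefficients are
  integrals of products of decaying functions, and its derivative at \<open>\<epsilon> = 0\<close> is the linear
  coefficient; no limit has to be exchanged with an integral. This yields
  \<open>\<delta>H\<^sub>1/\<delta>\<rho> = \<alpha>\<rho>u\<close>, \<open>\<delta>H\<^sub>2/\<delta>u = \<rho>u\<close> and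
  \<open>\<delta>H\<^sub>1/\<delta>u = \<delta>H\<^sub>2/\<delta>\<rho> = (u\<^sup>2 + \<alpha>\<rho>\<^sup>2) / 2\<close>,
  and applying either operator to the corresponding gradient gives minus the \<open>x\<close>-derivatives of the
  fluxes \<open>\<rho>u\<close> and \<open>(u\<^sup>2 + \<alpha>\<rho>\<^sup>2) / 2\<close> of the system.

  The analytic input is that the space of decaying smooth functions is an algebra closed under
  differentiation (\<open>decaying_smooth_mult\<close>), that products of two of its members are integrable
  (\<open>integrable_mult_decaying_smooth\<close>), and that derivatives of such products integrate to zero. The
  last fact gives integration by parts (\<open>integral_deriv_mult_decaying_smooth\<close>) and hence the
  anti-symmetry of both operators. Uniqueness of the variational derivative, needed because it is
  defined by a definite description, follows by testing with the difference of two candidates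
  (\<open>has_variational_derivative_unique\<close>).
\<close>

section \<open>The algebra of decaying smooth functions\<close>

text \<open>The conditions that the definition of \<^const>\<open>decaying_smooth\<close> puts on each single derivative.\<close>

definition diff_L2_vanishing :: "(real \<Rightarrow> real) \<Rightarrow> bool" where
  "diff_L2_vanishing f \<longleftrightarrow>
     (\<forall>x. f differentiable (at x)) \<and> integrable lborel (\<lambda>x. (f x)\<^sup>2) \<and> (f \<longlongrightarrow> 0) at_infinity"

lemma decaying_smooth_iff:
  "f \<in> decaying_smooth \<longleftrightarrow> (\<forall>n. diff_L2_vanishing ((deriv ^^ n) f))"
  by (simp add: decaying_smooth_def diff_L2_vanishing_def)

lemma decaying_smooth_imp_diff_L2_vanishing:
  "f \<in> decaying_smooth \<Longrightarrow> diff_L2_vanishing f"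
  unfolding decaying_smooth_iff by (drule spec[of _ 0]) simp

lemma decaying_smooth_deriv:
  assumes "f \<in> decaying_smooth"
  shows "deriv f \<in> decaying_smooth"
  unfolding decaying_smooth_iff
proof
  fix n
  show "diff_L2_vanishing ((deriv ^^ n) (deriv f))"
    using assms[unfolded decaying_smooth_iff, rule_format, of "Suc n"]
    by (simp only: funpow_Suc_right o_apply)
qed

text \<open>
  The decaying smooth functions form the largest set of functions satisfying
  \<^const>\<open>diff_L2_vanishing\<close> that is closed under differentiation. Closure properties are proved with
  this principle, which avoids formulas for iterated derivatives.
\<close>

lemma decaying_smooth_coinduct:
  assumes "f \<in> S"
    and "\<And>g. g \<in> S \<Longrightarrow> diff_L2_vanishing g"
    and "\<And>g. g \<in> S \<Longrightarrow> deriv g \<in> S"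
  shows "f \<in> decaying_smooth"
proof -
  have "(deriv ^^ n) f \<in> S" for n
    by (induction n) (use assms in auto)
  then show ?thesis
    using assms(2) by (auto simp: decaying_smooth_iff)
qed

lemma diff_L2_vanishing_DERIV:
  "diff_L2_vanishing f \<Longrightarrow> (f has_real_derivative deriv f x) (at x)"
  unfolding diff_L2_vanishing_def
  by (metis DERIV_deriv_iff_real_differentiable)

lemma decaying_smooth_DERIV:
  "f \<in> decaying_smooth \<Longrightarrow> (f has_real_derivative deriv f x) (at x)"
  by (intro diff_L2_vanishing_DERIV decaying_smooth_imp_diff_L2_vanishing)

lemma diff_L2_vanishing_continuous:
  "diff_L2_vanishing f \<Longrightarrow> continuous_on UNIV f"
  by (meson DERIV_continuous_on diff_L2_vanishing_DERIV has_field_derivative_at_within)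

lemma diff_L2_vanishing_measurable:
  "diff_L2_vanishing f \<Longrightarrow> f \<in> borel_measurable borel"
  by (intro borel_measurable_continuous_onI diff_L2_vanishing_continuous)

lemma diff_L2_vanishing_bounded:
  assumes "diff_L2_vanishing f"
  obtains B where "\<And>x. \<bar>f x\<bar> \<le> B"
proof -
  have "\<forall>\<^sub>F x in at_infinity. dist (f x) 0 < 1"
    using assms by (intro tendstoD) (auto simp: diff_L2_vanishing_def)
  then obtain R where R: "\<And>x. R \<le> norm x \<Longrightarrow> \<bar>f x\<bar> < 1"
    by (auto simp: eventually_at_infinity)
  have "compact (f ` cball 0 R)"
    using continuous_on_subset[OF diff_L2_vanishing_continuous[OF assms]]
    by (intro compact_continuous_image) auto
  then obtain C where C: "\<And>x. x \<in> cball 0 R \<Longrightarrow> \<bar>f x\<bar> \<le> C"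
    by (force dest!: compact_imp_bounded simp: bounded_iff)
  have "\<bar>f x\<bar> \<le> max 1 C" for x
    using R[of x] C[of x] by (cases "R \<le> norm x") (auto simp: le_max_iff_disj)
  then show ?thesis by (rule that)
qed

lemma diff_L2_vanishing_add:
  assumes f: "diff_L2_vanishing f" and g: "diff_L2_vanishing g"
  shows "diff_L2_vanishing (\<lambda>x. f x + g x)"
proof -
  have "integrable lborel (\<lambda>x. (f x + g x)\<^sup>2)"
  proof (rule Bochner_Integration.integrable_bound)
    show "integrable lborel (\<lambda>x. 2 * (f x)\<^sup>2 + 2 * (g x)\<^sup>2)"
      using f g by (auto simp: diff_L2_vanishing_def)
    show "(\<lambda>x. (f x + g x)\<^sup>2) \<in> borel_measurable lborel"
      using diff_L2_vanishing_measurable[OF f] diff_L2_vanishing_measurable[OF g] by simp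
    have "(f x + g x)\<^sup>2 \<le> 2 * (f x)\<^sup>2 + 2 * (g x)\<^sup>2" for x
      using zero_le_power2[of "f x - g x"] by (simp add: power2_eq_square algebra_simps)
    then show "AE x in lborel. norm ((f x + g x)\<^sup>2) \<le> norm (2 * (f x)\<^sup>2 + 2 * (g x)\<^sup>2)"
      by auto
  qed
  with f g show ?thesis
    by (auto simp: diff_L2_vanishing_def intro!: tendsto_eq_intros)
qed

lemma diff_L2_vanishing_cmult:
  "diff_L2_vanishing f \<Longrightarrow> diff_L2_vanishing (\<lambda>x. c * f x)"
  by (auto simp: diff_L2_vanishing_def power_mult_distrib intro!: tendsto_mult_right_zero)

lemma diff_L2_vanishing_mult:
  assumes f: "diff_L2_vanishing f" and g: "diff_L2_vanishing g"
  shows "diff_L2_vanishing (\<lambda>x. f x * g x)"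
proof -
  obtain B where B: "\<And>x. \<bar>f x\<bar> \<le> B"
    using diff_L2_vanishing_bounded[OF f] by blast
  have "integrable lborel (\<lambda>x. (f x * g x)\<^sup>2)"
  proof (rule Bochner_Integration.integrable_bound)
    show "integrable lborel (\<lambda>x. B\<^sup>2 * (g x)\<^sup>2)"
      using g by (auto simp: diff_L2_vanishing_def)
    show "(\<lambda>x. (f x * g x)\<^sup>2) \<in> borel_measurable lborel"
      using diff_L2_vanishing_measurable[OF f] diff_L2_vanishing_measurable[OF g] by simp
    have "(f x)\<^sup>2 \<le> B\<^sup>2" for x
      using B[of x] by (simp add: abs_le_square_iff[symmetric])
    then show "AE x in lborel. norm ((f x * g x)\<^sup>2) \<le> norm (B\<^sup>2 * (g x)\<^sup>2)"
      by (auto simp: power_mult_distrib intro!: mult_right_mono)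
  qed
  with f g show ?thesis
    by (auto simp: diff_L2_vanishing_def intro!: tendsto_eq_intros)
qed

lemma deriv_add_diff_L2_vanishing:
  "diff_L2_vanishing f \<Longrightarrow> diff_L2_vanishing g \<Longrightarrow>
    deriv (\<lambda>x. f x + g x) = (\<lambda>x. deriv f x + deriv g x)"
  by (intro ext DERIV_imp_deriv DERIV_add diff_L2_vanishing_DERIV)

lemma deriv_mult_decaying_smooth:
  assumes "f \<in> decaying_smooth" "g \<in> decaying_smooth"
  shows "deriv (\<lambda>x. f x * g x) = (\<lambda>x. deriv f x * g x + f x * deriv g x)"
  by (rule ext, rule DERIV_imp_deriv)
    (auto intro!: derivative_eq_intros decaying_smooth_DERIV assms)

lemma deriv_cmult_decaying_smooth:
  assumes "f \<in> decaying_smooth"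
  shows "deriv (\<lambda>x. c * f x) = (\<lambda>x. c * deriv f x)"
  by (intro ext DERIV_imp_deriv DERIV_cmult decaying_smooth_DERIV assms)

lemma decaying_smooth_cmult:
  assumes "f \<in> decaying_smooth"
  shows "(\<lambda>x. c * f x) \<in> decaying_smooth"
proof (rule decaying_smooth_coinduct)
  show "(\<lambda>x. c * f x) \<in> (\<lambda>g x. c * g x) ` decaying_smooth"
    using assms by (rule imageI)
qed (auto simp: deriv_cmult_decaying_smooth
      intro: diff_L2_vanishing_cmult decaying_smooth_imp_diff_L2_vanishing decaying_smooth_deriv)

lemma decaying_smooth_minus:
  "f \<in> decaying_smooth \<Longrightarrow> (\<lambda>x. - f x) \<in> decaying_smooth"
  using decaying_smooth_cmult[of f "-1"] by simp

text \<open>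
  Finite sums of products of decaying smooth functions: by the Leibniz rule this set is closed under
  differentiation, so it lies in \<^const>\<open>decaying_smooth\<close>, which is thus closed under products.
\<close>

inductive_set sums_of_products :: "(real \<Rightarrow> real) set" where
  mult: "f \<in> decaying_smooth \<Longrightarrow> g \<in> decaying_smooth \<Longrightarrow> (\<lambda>x. f x * g x) \<in> sums_of_products"
| add: "f \<in> sums_of_products \<Longrightarrow> g \<in> sums_of_products \<Longrightarrow> (\<lambda>x. f x + g x) \<in> sums_of_products"

lemma sums_of_products_diff_L2_vanishing:
  "f \<in> sums_of_products \<Longrightarrow> diff_L2_vanishing f"
  by (induction rule: sums_of_products.induct)
    (auto intro: diff_L2_vanishing_mult diff_L2_vanishing_add decaying_smooth_imp_diff_L2_vanishing)

lemma sums_of_products_deriv: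
  "f \<in> sums_of_products \<Longrightarrow> deriv f \<in> sums_of_products"
  by (induction rule: sums_of_products.induct)
    (auto simp: deriv_mult_decaying_smooth deriv_add_diff_L2_vanishing
        sums_of_products_diff_L2_vanishing
      intro!: sums_of_products.intros decaying_smooth_deriv)

lemma decaying_smooth_mult:
  "f \<in> decaying_smooth \<Longrightarrow> g \<in> decaying_smooth \<Longrightarrow> (\<lambda>x. f x * g x) \<in> decaying_smooth"
  by (rule decaying_smooth_coinduct[OF sums_of_products.mult])
    (auto intro: sums_of_products_diff_L2_vanishing sums_of_products_deriv)

lemma decaying_smooth_add:
  assumes "f \<in> decaying_smooth" "g \<in> decaying_smooth"
  shows "(\<lambda>x. f x + g x) \<in> decaying_smooth"
proof (rule decaying_smooth_coinduct)
  show "(\<lambda>x. f x + g x) \<in> {\<lambda>x. a x + b x |a b. a \<in> decaying_smooth \<and> b \<in> decaying_smooth}"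
    using assms by auto
next
  fix g :: "real \<Rightarrow> real"
  assume "g \<in> {\<lambda>x. a x + b x |a b. a \<in> decaying_smooth \<and> b \<in> decaying_smooth}"
  then obtain a b where ab: "g = (\<lambda>x. a x + b x)" "a \<in> decaying_smooth" "b \<in> decaying_smooth"
    by auto
  then show "diff_L2_vanishing g"
    by (simp add: diff_L2_vanishing_add decaying_smooth_imp_diff_L2_vanishing)
  show "deriv g \<in> {\<lambda>x. a x + b x |a b. a \<in> decaying_smooth \<and> b \<in> decaying_smooth}"
    using ab decaying_smooth_deriv
    by (auto simp: deriv_add_diff_L2_vanishing decaying_smooth_imp_diff_L2_vanishing)
qed

lemma decaying_smooth_diff:
  "f \<in> decaying_smooth \<Longrightarrow> g \<in> decaying_smooth \<Longrightarrow> (\<lambda>x. f x - g x) \<in> decaying_smooth"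
  using decaying_smooth_add[OF _ decaying_smooth_minus[of g]] by simp

section \<open>Integration by parts and the fundamental lemma\<close>

lemma integrable_mult_decaying_smooth:
  assumes "f \<in> decaying_smooth" "g \<in> decaying_smooth"
  shows "integrable lborel (\<lambda>x. f x * g x)"
proof (rule Bochner_Integration.integrable_bound)
  note fg = assms[THEN decaying_smooth_imp_diff_L2_vanishing]
  show "integrable lborel (\<lambda>x. (f x)\<^sup>2 + (g x)\<^sup>2)"
    using fg by (auto simp: diff_L2_vanishing_def)
  show "(\<lambda>x. f x * g x) \<in> borel_measurable lborel"
    using fg[THEN diff_L2_vanishing_measurable] by simp
  have "\<bar>f x * g x\<bar> \<le> (f x)\<^sup>2 + (g x)\<^sup>2" for x
  proof -
    have "2 * \<bar>f x\<bar> * \<bar>g x\<bar> \<le> \<bar>f x\<bar>\<^sup>2 + \<bar>g x\<bar>\<^sup>2"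
      by (rule sum_squares_bound)
    then show ?thesis
      using abs_ge_zero[of "f x * g x"] unfolding abs_mult power2_abs by linarith
  qed
  then show "AE x in lborel. norm (f x * g x) \<le> norm ((f x)\<^sup>2 + (g x)\<^sup>2)"
    by auto
qed

lemma integral_deriv_decaying_smooth_eq_0:
  assumes "f \<in> decaying_smooth" "integrable lborel (deriv f)"
  shows "(LBINT x. deriv f x) = 0"
proof -
  have lim: "(f \<longlongrightarrow> 0) at_infinity"
    using decaying_smooth_imp_diff_L2_vanishing[OF assms(1)] by (simp add: diff_L2_vanishing_def)
  have "(LBINT x=-\<infinity>..\<infinity>. deriv f x) = 0 - 0"
  proof (rule interval_integral_FTC_integrable)
    show "(f has_vector_derivative deriv f x) (at x)" for x
      using decaying_smooth_DERIV[OF assms(1)]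
      by (simp add: has_real_derivative_iff_has_vector_derivative)
    show "isCont (deriv f) x" for x
      using decaying_smooth_DERIV[OF decaying_smooth_deriv[OF assms(1)]] by (rule DERIV_isCont)
    show "set_integrable lborel (einterval (-\<infinity>) \<infinity>) (deriv f)"
      using assms(2) by (simp add: set_integrable_def)
    show "((f \<circ> real_of_ereal) \<longlongrightarrow> 0) (at_right (-\<infinity>))" "((f \<circ> real_of_ereal) \<longlongrightarrow> 0) (at_left \<infinity>)"
      unfolding ereal_tendsto_simps
      by (rule tendsto_mono[OF at_bot_le_at_infinity lim] tendsto_mono[OF at_top_le_at_infinity lim])+
  qed simp
  then show ?thesis
    by (simp add: interval_lebesgue_integral_def set_lebesgue_integral_def)
qed

lemma integral_deriv_mult_decaying_smooth:
  assumes "f \<in> decaying_smooth" "g \<in> decaying_smooth"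
  shows "(LBINT x. deriv f x * g x) = - (LBINT x. f x * deriv g x)"
proof -
  have int: "integrable lborel (\<lambda>x. deriv f x * g x)" "integrable lborel (\<lambda>x. f x * deriv g x)"
    using assms by (auto intro: integrable_mult_decaying_smooth decaying_smooth_deriv)
  have "(LBINT x. deriv (\<lambda>x. f x * g x) x) = 0"
    using assms int
    by (intro integral_deriv_decaying_smooth_eq_0 decaying_smooth_mult)
      (auto simp: deriv_mult_decaying_smooth)
  then show ?thesis
    using int by (simp add: deriv_mult_decaying_smooth[OF assms])
qed

lemma decaying_smooth_eq_0_if_L2_norm_eq_0:
  assumes "f \<in> decaying_smooth" "(LBINT x. f x * f x) = 0"
  shows "f x = 0"
proof -
  have "AE x in lborel. f x * f x = 0"
    using assms integral_nonneg_eq_0_iff_AE[OF integrable_mult_decaying_smooth[OF assms(1,1)]]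
    by simp
  then have ae: "AE x in lborel. x \<in> {x. f x = 0}"
    by simp
  have "continuous_on UNIV f"
    using assms(1) by (intro diff_L2_vanishing_continuous decaying_smooth_imp_diff_L2_vanishing)
  then have "closed {x. f x = 0}"
    by (intro closed_Collect_eq) auto
  from mem_closed_if_AE_lebesgue[OF this AE_completion[OF ae]] show ?thesis
    by simp
qed

section \<open>Variational derivatives of cubic functionals\<close>

lemma has_variational_derivative_unique:
  assumes "has_variational_derivative F f g" "has_variational_derivative F f h"
  shows "g = h"
proof -
  define d where "d = (\<lambda>x. g x - h x)"
  have gh: "g \<in> decaying_smooth" "h \<in> decaying_smooth"
    using assms by (auto simp: has_variational_derivative_def)
  then have d: "d \<in> decaying_smooth"
    by (auto simp: d_def intro: decaying_smooth_diff)
  have "(LBINT x. g x * d x) = (LBINT x. h x * d x)"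
    using assms d unfolding has_variational_derivative_def by (blast intro: DERIV_unique)
  moreover have "(LBINT x. d x * d x) = (LBINT x. g x * d x - h x * d x)"
    by (simp add: d_def algebra_simps)
  ultimately have "(LBINT x. d x * d x) = 0"
    using gh d by (simp add: integrable_mult_decaying_smooth)
  then show ?thesis
    using decaying_smooth_eq_0_if_L2_norm_eq_0[OF d] by (auto simp: d_def)
qed

lemma variational_derivative_eqI:
  "has_variational_derivative F f g \<Longrightarrow> variational_derivative F f = g"
  unfolding variational_derivative_def
  by (rule the_equality) (auto intro: has_variational_derivative_unique)

text \<open>
  If along every direction \<open>\<phi>\<close> the integrand is a polynomial of degree at most three in \<open>\<epsilon>\<close> with
  linear coefficient \<open>g \<phi>\<close>, then \<open>g\<close> is the variational derivative; the higher coefficients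
  \<open>C \<phi>\<close> and \<open>E \<phi>\<close> matter only through their integrability.
\<close>

lemma has_variational_derivativeI:
  assumes g: "g \<in> decaying_smooth" and A: "integrable lborel A"
    and C: "\<And>\<phi>. \<phi> \<in> decaying_smooth \<Longrightarrow> integrable lborel (C \<phi>)"
    and E: "\<And>\<phi>. \<phi> \<in> decaying_smooth \<Longrightarrow> integrable lborel (E \<phi>)"
    and F: "\<And>\<phi> \<epsilon>. \<phi> \<in> decaying_smooth \<Longrightarrow> F (\<lambda>x. f x + \<epsilon> * \<phi> x) =
      (LBINT x. A x + \<epsilon> * (g x * \<phi> x) + \<epsilon>\<^sup>2 * C \<phi> x + \<epsilon> ^ 3 * E \<phi> x)"
  shows "has_variational_derivative F f g"
  unfolding has_variational_derivative_def
proof (intro conjI g ballI)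
  fix \<phi> :: "real \<Rightarrow> real"
  assume \<phi>: "\<phi> \<in> decaying_smooth"
  have "F (\<lambda>x. f x + \<epsilon> * \<phi> x) = integral\<^sup>L lborel A + \<epsilon> * (LBINT x. g x * \<phi> x)
      + \<epsilon>\<^sup>2 * integral\<^sup>L lborel (C \<phi>) + \<epsilon> ^ 3 * integral\<^sup>L lborel (E \<phi>)" for \<epsilon>
    unfolding F[OF \<phi>] using A C[OF \<phi>] E[OF \<phi>] integrable_mult_decaying_smooth[OF g \<phi>] by simp
  then show "((\<lambda>\<epsilon>. F (\<lambda>x. f x + \<epsilon> * \<phi> x)) has_real_derivative (LBINT x. g x * \<phi> x)) (at 0)"
    by (auto intro!: derivative_eq_intros)
qed

lemma decaying_smooth_flux:
  assumes "\<rho> \<in> decaying_smooth" "u \<in> decaying_smooth"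
  shows "(\<lambda>x. ((u x)\<^sup>2 + \<alpha> * (\<rho> x)\<^sup>2) / 2) \<in> decaying_smooth"
proof -
  have "(\<lambda>x. 1 / 2 * (u x * u x + \<alpha> * (\<rho> x * \<rho> x))) \<in> decaying_smooth"
    by (intro decaying_smooth_cmult decaying_smooth_add decaying_smooth_mult assms)
  then show ?thesis
    by (simp add: power2_eq_square)
qed

lemma integrable_mult3_decaying_smooth:
  assumes "f \<in> decaying_smooth" "g \<in> decaying_smooth" "h \<in> decaying_smooth"
  shows "integrable lborel (\<lambda>x. c * (f x * g x * h x))"
  by (intro integrable_mult_right integrable_mult_decaying_smooth decaying_smooth_mult assms)

lemma integrable_H1u_integrand:
  assumes "\<rho> \<in> decaying_smooth" "u \<in> decaying_smooth"
  shows "integrable lborel (\<lambda>x. 1 / 6 * u x ^ 3 + \<alpha> / 2 * (\<rho> x)\<^sup>2 * u x)"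
proof -
  have "integrable lborel (\<lambda>x. 1 / 6 * (u x * u x * u x) + \<alpha> / 2 * (\<rho> x * \<rho> x * u x))"
    by (intro Bochner_Integration.integrable_add integrable_mult3_decaying_smooth assms)
  then show ?thesis
    by (simp add: power2_eq_square power3_eq_cube mult.assoc)
qed

lemma H1u_has_variational_derivative_rho:
  assumes "\<rho> \<in> decaying_smooth" "u \<in> decaying_smooth"
  shows "has_variational_derivative (\<lambda>r. H1u \<alpha> r u) \<rho> (\<lambda>x. \<alpha> * (\<rho> x * u x))"
proof (rule has_variational_derivativeI)
  show "(\<lambda>x. \<alpha> * (\<rho> x * u x)) \<in> decaying_smooth"
    by (intro decaying_smooth_cmult decaying_smooth_mult assms)
  show "integrable lborel (\<lambda>x. 1 / 6 * u x ^ 3 + \<alpha> / 2 * (\<rho> x)\<^sup>2 * u x)"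
    by (rule integrable_H1u_integrand[OF assms])
  show "integrable lborel (\<lambda>x. \<alpha> / 2 * (\<phi> x * \<phi> x * u x))" if "\<phi> \<in> decaying_smooth" for \<phi>
    by (intro integrable_mult3_decaying_smooth that assms)
  show "integrable lborel (\<lambda>x. 0)" ..
  show "H1u \<alpha> (\<lambda>x. \<rho> x + \<epsilon> * \<phi> x) u =
      (LBINT x. 1 / 6 * u x ^ 3 + \<alpha> / 2 * (\<rho> x)\<^sup>2 * u x + \<epsilon> * (\<alpha> * (\<rho> x * u x) * \<phi> x)
        + \<epsilon>\<^sup>2 * (\<alpha> / 2 * (\<phi> x * \<phi> x * u x)) + \<epsilon> ^ 3 * 0)" for \<phi> \<epsilon>
    unfolding H1u_def
    by (intro Bochner_Integration.integral_cong refl)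
      (simp add: power2_eq_square power3_eq_cube algebra_simps)
qed

lemma H1u_has_variational_derivative_u:
  assumes "\<rho> \<in> decaying_smooth" "u \<in> decaying_smooth"
  shows "has_variational_derivative (\<lambda>v. H1u \<alpha> \<rho> v) u (\<lambda>x. ((u x)\<^sup>2 + \<alpha> * (\<rho> x)\<^sup>2) / 2)"
proof (rule has_variational_derivativeI)
  show "(\<lambda>x. ((u x)\<^sup>2 + \<alpha> * (\<rho> x)\<^sup>2) / 2) \<in> decaying_smooth"
    by (rule decaying_smooth_flux[OF assms])
  show "integrable lborel (\<lambda>x. 1 / 6 * u x ^ 3 + \<alpha> / 2 * (\<rho> x)\<^sup>2 * u x)"
    by (rule integrable_H1u_integrand[OF assms])
  show "integrable lborel (\<lambda>x. 1 / 2 * (u x * \<phi> x * \<phi> x))"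
    and "integrable lborel (\<lambda>x. 1 / 6 * (\<phi> x * \<phi> x * \<phi> x))" if "\<phi> \<in> decaying_smooth" for \<phi>
    by (intro integrable_mult3_decaying_smooth that assms)+
  show "H1u \<alpha> \<rho> (\<lambda>x. u x + \<epsilon> * \<phi> x) =
      (LBINT x. 1 / 6 * u x ^ 3 + \<alpha> / 2 * (\<rho> x)\<^sup>2 * u x
        + \<epsilon> * (((u x)\<^sup>2 + \<alpha> * (\<rho> x)\<^sup>2) / 2 * \<phi> x)
        + \<epsilon>\<^sup>2 * (1 / 2 * (u x * \<phi> x * \<phi> x)) + \<epsilon> ^ 3 * (1 / 6 * (\<phi> x * \<phi> x * \<phi> x)))" for \<phi> \<epsilon>
    unfolding H1u_def
    by (intro Bochner_Integration.integral_cong refl)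
      (simp add: power2_eq_square power3_eq_cube field_simps)
qed

lemma integrable_H2u_integrand:
  assumes "\<rho> \<in> decaying_smooth" "u \<in> decaying_smooth"
  shows "integrable lborel (\<lambda>x. 1 / 2 * \<rho> x * (u x)\<^sup>2 + \<alpha> / 6 * \<rho> x ^ 3)"
proof -
  have "integrable lborel (\<lambda>x. 1 / 2 * (\<rho> x * u x * u x) + \<alpha> / 6 * (\<rho> x * \<rho> x * \<rho> x))"
    by (intro Bochner_Integration.integrable_add integrable_mult3_decaying_smooth assms)
  then show ?thesis
    by (simp add: power2_eq_square power3_eq_cube mult.assoc)
qed

lemma H2u_has_variational_derivative_rho:
  assumes "\<rho> \<in> decaying_smooth" "u \<in> decaying_smooth"
  shows "has_variational_derivative (\<lambda>r. H2u \<alpha> r u) \<rho> (\<lambda>x. ((u x)\<^sup>2 + \<alpha> * (\<rho> x)\<^sup>2) / 2)"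
proof (rule has_variational_derivativeI)
  show "(\<lambda>x. ((u x)\<^sup>2 + \<alpha> * (\<rho> x)\<^sup>2) / 2) \<in> decaying_smooth"
    by (rule decaying_smooth_flux[OF assms])
  show "integrable lborel (\<lambda>x. 1 / 2 * \<rho> x * (u x)\<^sup>2 + \<alpha> / 6 * \<rho> x ^ 3)"
    by (rule integrable_H2u_integrand[OF assms])
  show "integrable lborel (\<lambda>x. \<alpha> / 2 * (\<rho> x * \<phi> x * \<phi> x))"
    and "integrable lborel (\<lambda>x. \<alpha> / 6 * (\<phi> x * \<phi> x * \<phi> x))" if "\<phi> \<in> decaying_smooth" for \<phi>
    by (intro integrable_mult3_decaying_smooth that assms)+
  show "H2u \<alpha> (\<lambda>x. \<rho> x + \<epsilon> * \<phi> x) u =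
      (LBINT x. 1 / 2 * \<rho> x * (u x)\<^sup>2 + \<alpha> / 6 * \<rho> x ^ 3
        + \<epsilon> * (((u x)\<^sup>2 + \<alpha> * (\<rho> x)\<^sup>2) / 2 * \<phi> x)
        + \<epsilon>\<^sup>2 * (\<alpha> / 2 * (\<rho> x * \<phi> x * \<phi> x)) + \<epsilon> ^ 3 * (\<alpha> / 6 * (\<phi> x * \<phi> x * \<phi> x)))" for \<phi> \<epsilon>
    unfolding H2u_def
    by (intro Bochner_Integration.integral_cong refl)
      (simp add: power2_eq_square power3_eq_cube field_simps)
qed

lemma H2u_has_variational_derivative_u:
  assumes "\<rho> \<in> decaying_smooth" "u \<in> decaying_smooth"
  shows "has_variational_derivative (\<lambda>v. H2u \<alpha> \<rho> v) u (\<lambda>x. \<rho> x * u x)"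
proof (rule has_variational_derivativeI)
  show "(\<lambda>x. \<rho> x * u x) \<in> decaying_smooth"
    by (intro decaying_smooth_mult assms)
  show "integrable lborel (\<lambda>x. 1 / 2 * \<rho> x * (u x)\<^sup>2 + \<alpha> / 6 * \<rho> x ^ 3)"
    by (rule integrable_H2u_integrand[OF assms])
  show "integrable lborel (\<lambda>x. 1 / 2 * (\<rho> x * \<phi> x * \<phi> x))" if "\<phi> \<in> decaying_smooth" for \<phi>
    by (intro integrable_mult3_decaying_smooth that assms)
  show "integrable lborel (\<lambda>x. 0)" ..
  show "H2u \<alpha> \<rho> (\<lambda>x. u x + \<epsilon> * \<phi> x) =
      (LBINT x. 1 / 2 * \<rho> x * (u x)\<^sup>2 + \<alpha> / 6 * \<rho> x ^ 3 + \<epsilon> * (\<rho> x * u x * \<phi> x)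
        + \<epsilon>\<^sup>2 * (1 / 2 * (\<rho> x * \<phi> x * \<phi> x)) + \<epsilon> ^ 3 * 0)" for \<phi> \<epsilon>
    unfolding H2u_def
    by (intro Bochner_Integration.integral_cong refl)
      (simp add: power2_eq_square power3_eq_cube algebra_simps)
qed

section \<open>The bi-Hamiltonian structure\<close>

lemma anti_symmetric_J_op: "anti_symmetric (J_op \<alpha>)"
  unfolding anti_symmetric_def
proof (intro conjI ballI)
  fix F :: "(real \<Rightarrow> real) \<times> (real \<Rightarrow> real)"
  assume F: "F \<in> decaying_smooth \<times> decaying_smooth"
  then show "J_op \<alpha> F \<in> decaying_smooth \<times> decaying_smooth"
    unfolding J_op_def
    by (intro SigmaI decaying_smooth_cmult decaying_smooth_minus decaying_smooth_deriv) auto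
  fix G :: "(real \<Rightarrow> real) \<times> (real \<Rightarrow> real)"
  assume G: "G \<in> decaying_smooth \<times> decaying_smooth"
  obtain f1 f2 g1 g2 where eq: "F = (f1, f2)" "G = (g1, g2)"
    by (metis surj_pair)
  have D: "f1 \<in> decaying_smooth" "f2 \<in> decaying_smooth" "g1 \<in> decaying_smooth" "g2 \<in> decaying_smooth"
    using F G by (auto simp: eq)
  note D' = D[THEN decaying_smooth_deriv]
  have "L2_pairing (J_op \<alpha> F) G = (LBINT x. - (1 / \<alpha>) * (deriv f1 x * g1 x) - deriv f2 x * g2 x)"
    by (simp add: L2_pairing_def J_op_def eq)
  also have "\<dots> = - (1 / \<alpha>) * (LBINT x. deriv f1 x * g1 x) - (LBINT x. deriv f2 x * g2 x)"
    using D D' by (simp add: integrable_mult_decaying_smooth)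
  also have "\<dots> = (1 / \<alpha>) * (LBINT x. f1 x * deriv g1 x) + (LBINT x. f2 x * deriv g2 x)"
    using D by (simp add: integral_deriv_mult_decaying_smooth)
  also have "\<dots> = - (LBINT x. - (1 / \<alpha>) * (f1 x * deriv g1 x) - f2 x * deriv g2 x)"
    using D D' by (simp add: integrable_mult_decaying_smooth)
  also have "\<dots> = - L2_pairing F (J_op \<alpha> G)"
    by (simp add: L2_pairing_def J_op_def eq)
  finally show "L2_pairing (J_op \<alpha> F) G = - L2_pairing F (J_op \<alpha> G)" .
qed

lemma anti_symmetric_K_op: "anti_symmetric K_op"
  unfolding anti_symmetric_def
proof (intro conjI ballI)
  fix F :: "(real \<Rightarrow> real) \<times> (real \<Rightarrow> real)"
  assume F: "F \<in> decaying_smooth \<times> decaying_smooth"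
  then show "K_op F \<in> decaying_smooth \<times> decaying_smooth"
    unfolding K_op_def
    by (intro SigmaI decaying_smooth_minus decaying_smooth_deriv) auto
  fix G :: "(real \<Rightarrow> real) \<times> (real \<Rightarrow> real)"
  assume G: "G \<in> decaying_smooth \<times> decaying_smooth"
  obtain f1 f2 g1 g2 where eq: "F = (f1, f2)" "G = (g1, g2)"
    by (metis surj_pair)
  have D: "f1 \<in> decaying_smooth" "f2 \<in> decaying_smooth" "g1 \<in> decaying_smooth" "g2 \<in> decaying_smooth"
    using F G by (auto simp: eq)
  note D' = D[THEN decaying_smooth_deriv]
  have "L2_pairing (K_op F) G = (LBINT x. - (deriv f2 x * g1 x) - deriv f1 x * g2 x)"
    by (simp add: L2_pairing_def K_op_def eq)
  also have "\<dots> = - (LBINT x. deriv f2 x * g1 x) - (LBINT x. deriv f1 x * g2 x)"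
    using D D' by (simp add: integrable_mult_decaying_smooth)
  also have "\<dots> = (LBINT x. f2 x * deriv g1 x) + (LBINT x. f1 x * deriv g2 x)"
    using D by (simp add: integral_deriv_mult_decaying_smooth)
  also have "\<dots> = - (LBINT x. - (f1 x * deriv g2 x) - f2 x * deriv g1 x)"
    using D D' by (simp add: integrable_mult_decaying_smooth)
  also have "\<dots> = - L2_pairing F (K_op G)"
    by (simp add: L2_pairing_def K_op_def eq)
  finally show "L2_pairing (K_op F) G = - L2_pairing F (K_op G)" .
qed

lemma J_op_gradient_H1u:
  assumes "\<alpha> \<noteq> 0" "\<rho> \<in> decaying_smooth" "u \<in> decaying_smooth"
  shows "J_op \<alpha> (delta_rho (H1u \<alpha>) \<rho> u, delta_u (H1u \<alpha>) \<rho> u) =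
    (\<lambda>x. - deriv (\<lambda>y. \<rho> y * u y) x, \<lambda>x. - deriv (\<lambda>y. ((u y)\<^sup>2 + \<alpha> * (\<rho> y)\<^sup>2) / 2) x)"
  using assms(1)
  by (simp add: J_op_def delta_rho_def delta_u_def
      variational_derivative_eqI[OF H1u_has_variational_derivative_rho[OF assms(2,3)]]
      variational_derivative_eqI[OF H1u_has_variational_derivative_u[OF assms(2,3)]]
      deriv_cmult_decaying_smooth[OF decaying_smooth_mult[OF assms(2,3)]])

lemma K_op_gradient_H2u:
  assumes "\<rho> \<in> decaying_smooth" "u \<in> decaying_smooth"
  shows "K_op (delta_rho (H2u \<alpha>) \<rho> u, delta_u (H2u \<alpha>) \<rho> u) =
    (\<lambda>x. - deriv (\<lambda>y. \<rho> y * u y) x, \<lambda>x. - deriv (\<lambda>y. ((u y)\<^sup>2 + \<alpha> * (\<rho> y)\<^sup>2) / 2) x)"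
  by (simp add: K_op_def delta_rho_def delta_u_def
      variational_derivative_eqI[OF H2u_has_variational_derivative_rho[OF assms]]
      variational_derivative_eqI[OF H2u_has_variational_derivative_u[OF assms]])

text \<open>
  A field satisfies a Hamiltonian system whose right-hand side is minus the \<open>x\<close>-derivative of the
  Burgers fluxes exactly when it satisfies the coupled Burgers system.
\<close>

lemma coupled_burgers_iff_hamiltonian_form:
  assumes "\<And>t. t > 0 \<Longrightarrow> A (delta_rho H (\<rho> t) (u t), delta_u H (\<rho> t) (u t)) =
    (\<lambda>x. - deriv (\<lambda>y. \<rho> t y * u t y) x,
     \<lambda>x. - deriv (\<lambda>y. ((u t y)\<^sup>2 + \<alpha> * (\<rho> t y)\<^sup>2) / 2) x)"
  shows "coupled_burgers \<alpha> \<rho> u \<longleftrightarrow> hamiltonian_form A H \<rho> u"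
  unfolding coupled_burgers_def hamiltonian_form_def
  using assms by (auto simp: fun_eq_iff eq_neg_iff_add_eq_0)

theorem theorem3p1:
  fixes \<alpha> :: real
  assumes "\<alpha> \<noteq> 0"
  shows "anti_symmetric (J_op \<alpha>) \<and> anti_symmetric K_op \<and>
    variationally_differentiable (H1u \<alpha>) \<and> variationally_differentiable (H2u \<alpha>) \<and>
    (\<forall>\<rho> u :: real \<Rightarrow> real \<Rightarrow> real. admissible_field \<rho> \<and> admissible_field u \<longrightarrow>
       (coupled_burgers \<alpha> \<rho> u \<longleftrightarrow> hamiltonian_form (J_op \<alpha>) (H1u \<alpha>) \<rho> u) \<and>
       (coupled_burgers \<alpha> \<rho> u \<longleftrightarrow> hamiltonian_form K_op (H2u \<alpha>) \<rho> u))"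
proof (intro conjI allI impI anti_symmetric_J_op anti_symmetric_K_op)
  show "variationally_differentiable (H1u \<alpha>)"
    unfolding variationally_differentiable_def
    by (blast intro: H1u_has_variational_derivative_rho H1u_has_variational_derivative_u)
  show "variationally_differentiable (H2u \<alpha>)"
    unfolding variationally_differentiable_def
    by (blast intro: H2u_has_variational_derivative_rho H2u_has_variational_derivative_u)
next
  fix \<rho> u :: "real \<Rightarrow> real \<Rightarrow> real"
  assume "admissible_field \<rho> \<and> admissible_field u"
  then have D: "\<rho> t \<in> decaying_smooth" "u t \<in> decaying_smooth" if "t > 0" for t
    using that by (auto simp: admissible_field_def)
  show "coupled_burgers \<alpha> \<rho> u \<longleftrightarrow> hamiltonian_form (J_op \<alpha>) (H1u \<alpha>) \<rho> u"
    by (intro coupled_burgers_iff_hamiltonian_form J_op_gradient_H1u assms D)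
  show "coupled_burgers \<alpha> \<rho> u \<longleftrightarrow> hamiltonian_form K_op (H2u \<alpha>) \<rho> u"
    by (intro coupled_burgers_iff_hamiltonian_form K_op_gradient_H2u D)
qed

end
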